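(* There exist two positive absolute constants $b$ and $B$ such that the following holds. Let $\Omega$ be a compact subset of $\mathbb R^d$ ($d\ge 1$), let $\mu$ be a probability measure on $\Omega$, and let $\mathbf F$ be a compact subset of $\mathcal C(\Omega)$. Then for every $n=1,2,\dots$ $$ \varrho_{bn}(\mathbf F,L_2)\le B\, d_n(\mathbf F,L_\infty). $$
   Context: $\mathcal C(\Omega)$ is the space of continuous complex-valued functions on the compact set $\Omega\subset\mathbb R^d$, with the uniform norm $\|f\|_\infty:=\max_{\mathbf x\in\Omega}|f(\mathbf x)|$. This normed space is what $L_\infty$ refers to. For $1\le p<\infty$, $\|f\|_p:=\left(\int_\Omega|f|^p\,d\mu\right)^{1/p}$ is the norm of $L_p=L_p(\Omega,\mu)$, where $\mu$ is a (Borel) probability measure on $\Omega$. Optimal linear recovery. For a positive integer $m$, $$ \varrho_m(\mathbf F,L_2):=\inf_{\xi}\ \inf_{\Phi_\xi}\ \sup_{f\in\mathbf F}\|f-\Phi_\xi(f(\xi^1),\dots,f(\xi^m))\|_2, $$ where the infimum is over all collections of $m$ points $\xi=\{\xi^j\}_{j=1}^m\subset\Omega$ (not necessarily distinct) and all linear operators $\Phi_\xi:\mathbb C^m\to L_2(\Omega,\mu)$. If $bn$ is not an integer, $\varrho_{bn}$ means $\varrho_m$ with $m=\lfloor bn\rfloor$. Kolmogorov width in the uniform norm. For $n=1,2,\dots$, $$ d_n(\mathbf F,L_\infty):=\inf_{u_1,\dots,u_n\in\mathcal C(\Omega)}\ \sup_{f\in\mathbf F}\ \inf_{c_1,\dots,c_n\in\mathbb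 C}\Big\|f-\sum_{i=1}^n c_iu_i\Big\|_\infty . $$ "Absolute constants" means that $b,B$ do not depend on $d,\Omega,\mu,\mathbf F$ or $n$. *)

theory Defs
  imports "HOL-Probability.Probability"
begin

text \<open>The compact set \<open>\<Omega>\<close> enters as a topological space \<open>X\<close> with \<open>topspace X = \<Omega>\<close> (in the theorem,
  a compact subspace of \<^const>\<open>Euclidean_space\<close> \<open>d\<close>), so that the dimension \<open>d\<close> can be quantified
  after the absolute constants. For compact \<open>X\<close>, \<open>C_space X\<close> consists of all continuous
  complex-valued functions on \<open>X\<close> (\<^const>\<open>undefined\<close> outside \<open>topspace X\<close>), with the uniform
  distance.\<close>

abbreviation C_space :: "'a topology \<Rightarrow> ('a \<Rightarrow> complex) metric" where
  "C_space X \<equiv> cfunspace X euclidean_metric"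

definition borel_probability_on :: "'a topology \<Rightarrow> 'a measure \<Rightarrow> bool" where
  "borel_probability_on X \<mu> \<longleftrightarrow>
     prob_space \<mu> \<and> space \<mu> = topspace X \<and> sets \<mu> = sigma_sets (topspace X) {U. openin X U}"

text \<open>Norms and widths take values in \<^typ>\<open>ennreal\<close>, where all suprema and infima exist.\<close>

definition unif_norm :: "'a set \<Rightarrow> ('a \<Rightarrow> complex) \<Rightarrow> ennreal" where
  "unif_norm \<Omega> g = (SUP x\<in>\<Omega>. ennreal (cmod (g x)))"

lemma unif_norm_eq_mdist:
  assumes f: "f \<in> mspace (C_space X)" and g: "g \<in> mspace (C_space X)"
  shows "unif_norm (topspace X) (\<lambda>x. f x - g x) = ennreal (mdist (C_space X) f g)"
proof (rule antisym)
  show "unif_norm (topspace X) (\<lambda>x. f x - g x) \<le> ennreal (mdist (C_space X) f g)"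
    unfolding unif_norm_def
  proof (rule SUP_least)
    fix x assume "x \<in> topspace X"
    from mdist_cfunspace_imp_mdist_le[OF f g order_refl this]
    show "ennreal (cmod (f x - g x)) \<le> ennreal (mdist (C_space X) f g)"
      by (intro ennreal_leI) (simp add: dist_norm)
  qed
  show "ennreal (mdist (C_space X) f g) \<le> unif_norm (topspace X) (\<lambda>x. f x - g x)"
  proof (cases "unif_norm (topspace X) (\<lambda>x. f x - g x)")
    case (real r)
    have "mdist euclidean_metric (f x) (g x) \<le> r" if "x \<in> topspace X" for x
    proof -
      have "ennreal (cmod (f x - g x)) \<le> ennreal r"
        using SUP_upper[OF that, of "\<lambda>x. ennreal (cmod (f x - g x))"] real
        by (simp add: unif_norm_def)
      then show ?thesis
        using real by (simp add: dist_norm)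
    qed
    then have "mdist (C_space X) f g \<le> r"
      using real by (intro mdist_cfunspace_le) auto
    then show ?thesis
      using real by (simp add: ennreal_leI)
  qed simp
qed

text \<open>Elements of \<open>L\<^sub>2\<close> are represented by square-integrable functions; identities in \<open>L\<^sub>2\<close> are
  identities almost everywhere.\<close>

definition L2 :: "'a measure \<Rightarrow> ('a \<Rightarrow> complex) set" where
  "L2 \<mu> = {g \<in> borel_measurable \<mu>. integrable \<mu> (\<lambda>x. (cmod (g x))\<^sup>2)}"

definition L2_norm :: "'a measure \<Rightarrow> ('a \<Rightarrow> complex) \<Rightarrow> ennreal" where
  "L2_norm \<mu> g = ennreal (sqrt (\<integral>x. (cmod (g x))\<^sup>2 \<partial>\<mu>))"

text \<open>\<open>Cn m\<close> is \<open>\<complex>\<^sup>m\<close>, encoded like \<^const>\<open>Euclidean_space\<close> \<open>m\<close>: coordinates are indexed by \<open>j < m\<close>,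
  and all further entries vanish.\<close>

definition Cn :: "nat \<Rightarrow> (nat \<Rightarrow> complex) set" where
  "Cn m = {v. \<forall>j\<ge>m. v j = 0}"

definition linear_into_L2 :: "nat \<Rightarrow> 'a measure \<Rightarrow> ((nat \<Rightarrow> complex) \<Rightarrow> 'a \<Rightarrow> complex) \<Rightarrow> bool" where
  "linear_into_L2 m \<mu> \<Phi> \<longleftrightarrow>
     \<Phi> \<in> Cn m \<rightarrow> L2 \<mu> \<and>
     (\<forall>v\<in>Cn m. \<forall>w\<in>Cn m. AE x in \<mu>. \<Phi> (\<lambda>j. v j + w j) x = \<Phi> v x + \<Phi> w x) \<and>
     (\<forall>a. \<forall>v\<in>Cn m. AE x in \<mu>. \<Phi> (\<lambda>j. a * v j) x = a * \<Phi> v x)"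

definition samples :: "nat \<Rightarrow> (nat \<Rightarrow> 'a) \<Rightarrow> ('a \<Rightarrow> complex) \<Rightarrow> nat \<Rightarrow> complex" where
  "samples m \<xi> f = (\<lambda>j. if j < m then f (\<xi> j) else 0)"

text \<open>For \<open>m = 0\<close> no sample is taken, \<open>\<Phi>\<close> is zero almost everywhere, and \<open>opt_linear_recovery\<close> is
  the supremum of \<open>L2_norm \<mu> f\<close> over \<open>F\<close>.\<close>

definition opt_linear_recovery :: "'a topology \<Rightarrow> 'a measure \<Rightarrow> nat \<Rightarrow> ('a \<Rightarrow> complex) set \<Rightarrow> ennreal" where
  "opt_linear_recovery X \<mu> m F =
     (INF \<xi> \<in> {..<m} \<rightarrow> topspace X. INF \<Phi> \<in> Collect (linear_into_L2 m \<mu>).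
        SUP f\<in>F. L2_norm \<mu> (\<lambda>x. f x - \<Phi> (samples m \<xi> f) x))"

definition kolmogorov_width :: "'a topology \<Rightarrow> nat \<Rightarrow> ('a \<Rightarrow> complex) set \<Rightarrow> ennreal" where
  "kolmogorov_width X n F =
     (INF u \<in> {..<n} \<rightarrow> mspace (C_space X). SUP f\<in>F. INF c :: nat \<Rightarrow> complex.
        unif_norm (topspace X) (\<lambda>x. f x - (\<Sum>i<n. c i * u i x)))"

end

theory Submission
  imports Defs "Jordan_Normal_Form.Determinant"
begin

text \<open>Let \<open>v\<^sub>1, \<dots>, v\<^sub>N\<close> with \<open>N \<le> k = 2 n\<close> be an orthonormal system in real \<open>L\<^sub>2\<close> whose span contains the
  real and imaginary parts of given functions \<open>u\<^sub>1, \<dots>, u\<^sub>n\<close>. A one-sided version of the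
  Batson--Spielman--Srivastava barrier argument yields \<open>6 k\<close> points, all of weight one, with
  \<open>\<Sum>\<^sub>l \<bar>f (\<xi>\<^sub>l)\<bar>\<^sup>2 \<ge> k \<parallel>f\<parallel>\<^sup>2\<close> on the span: starting from \<open>B = k I\<close>, replace \<open>B\<close> by \<open>B - I/3 + v(x) v(x)\<^sup>T\<close>
  for a point \<open>x\<close> such that \<open>B\<close> stays positive definite and the trace of its inverse stays at most 1.
  Averaging over \<open>x\<close> shows that such a point exists. After \<open>6 k\<close> steps positivity of
  \<open>B = \<Sum>\<^sub>l v(\<xi>\<^sub>l) v(\<xi>\<^sub>l)\<^sup>T - k I\<close> is the claimed inequality. Least squares on the sample then
  recovers \<open>f\<close> up to a constant multiple of its uniform distance to the span. Since only an upper bound for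
  the sum of the weights is needed, no upper barrier occurs.\<close>

section \<open>Positive definite forms and their inverses\<close>

text \<open>Only the entries with indices below \<open>N\<close> of a vector or matrix matter. In \<open>inverse_cols N B s\<close>
  the vector \<open>s i\<close> is the \<open>i\<close>-th column of the inverse of \<open>B\<close>.\<close>

definition form :: "nat \<Rightarrow> (nat \<Rightarrow> nat \<Rightarrow> real) \<Rightarrow> (nat \<Rightarrow> real) \<Rightarrow> (nat \<Rightarrow> real) \<Rightarrow> real" where
  "form N B u w = (\<Sum>i<N. \<Sum>j<N. u i * B i j * w j)"

definition posdef :: "nat \<Rightarrow> (nat \<Rightarrow> nat \<Rightarrow> real) \<Rightarrow> bool" where
  "posdef N B \<longleftrightarrow> (\<forall>i j. B i j = B j i) \<and> (\<forall>w. (\<exists>i<N. w i \<noteq> 0) \<longrightarrow> 0 < form N B w w)"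

definition inverse_cols :: "nat \<Rightarrow> (nat \<Rightarrow> nat \<Rightarrow> real) \<Rightarrow> (nat \<Rightarrow> nat \<Rightarrow> real) \<Rightarrow> bool" where
  "inverse_cols N B s \<longleftrightarrow> (\<forall>i<N. \<forall>k<N. (\<Sum>j<N. B k j * s i j) = (if k = i then 1 else 0))"

lemma form_diff_left: "form N B (\<lambda>i. u i - v i) w = form N B u w - form N B v w"
  by (simp add: form_def left_diff_distrib sum_subtractf)

lemma form_scale_left: "form N B (\<lambda>i. a * u i) w = a * form N B u w"
  by (simp add: form_def sum_distrib_left mult.assoc)

lemma form_diff_right: "form N B w (\<lambda>i. u i - v i) = form N B w u - form N B w v"
  by (simp add: form_def right_diff_distrib sum_subtractf)

lemma form_scale_right: "form N B w (\<lambda>i. a * u i) = a * form N B w u"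
  by (simp add: form_def sum_distrib_left mult_ac)

lemma form_commute:
  assumes "posdef N B"
  shows "form N B u w = form N B w u"
proof -
  have "form N B u w = (\<Sum>j<N. \<Sum>i<N. u i * B i j * w j)"
    unfolding form_def by (rule sum.swap)
  also have "\<dots> = form N B w u"
    using assms unfolding form_def posdef_def
    by (intro sum.cong refl) (metis mult.commute mult.left_commute)
  finally show ?thesis .
qed

text \<open>\<open>B\<close> maps \<open>s i\<close> to the \<open>i\<close>-th unit vector, so
  \<open>s i\<close> represents the \<open>i\<close>-th coordinate functional with respect to the
  form. The estimates of inverse entries below rest on this reproducing property.\<close>

lemma form_inverse_right:
  assumes "inverse_cols N B s" "i < N"
  shows "form N B u (s i) = u i"
proof -
  have "form N B u (s i) = (\<Sum>k<N. u k * (\<Sum>j<N. B k j * s i j))"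
    by (simp add: form_def sum_distrib_left mult.assoc)
  also have "\<dots> = (\<Sum>k<N. u k * (if k = i then 1 else 0))"
    using assms by (intro sum.cong refl) (auto simp: inverse_cols_def)
  also have "\<dots> = (\<Sum>k<N. if k = i then u k else 0)"
    by (intro sum.cong) auto
  also have "\<dots> = u i"
    using assms(2) by simp
  finally show ?thesis .
qed

lemma form_inverse_left:
  assumes "posdef N B" "inverse_cols N B s" "i < N"
  shows "form N B (s i) u = u i"
  using form_commute[OF assms(1)] form_inverse_right[OF assms(2,3)] by metis

text \<open>Both entries are the value of the form at \<open>s j\<close> and \<open>s i\<close>,
  read off once through each argument.\<close>

lemma inverse_cols_commute:
  assumes "posdef N B" "inverse_cols N B s" "i < N" "j < N"
  shows "s i j = s j i"
  using form_inverse_right[OF assms(2,3), of "s j"] form_inverse_left[OF assms(1,2,4), of "s i"]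
  by simp

lemma form_self_nonneg: 
  assumes "posdef N B"
  shows "0 \<le> form N B w w"
proof (cases "\<exists>i<N. w i \<noteq> 0")
  case True
  then show ?thesis using assms by (auto simp: posdef_def intro: less_imp_le)
next
  case False
  then show ?thesis by (simp add: form_def)
qed

text \<open>The entry \<open>s i i\<close> is the form at \<open>s i\<close>, and \<open>s i\<close>
  is nonzero because \<open>B\<close> maps it to a unit vector.\<close>

lemma inverse_cols_diag_pos:
  assumes "posdef N B" "inverse_cols N B s" "i < N"
  shows "0 < s i i"
proof -
  have "\<exists>j<N. s i j \<noteq> 0"
  proof (rule ccontr)
    assume "\<not> ?thesis"
    then have "(\<Sum>j<N. B i j * s i j) = 0" by simp
    with assms(2,3) show False by (simp add: inverse_cols_def)
  qed
  then have "0 < form N B (s i) (s i)"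
    using assms(1) by (simp add: posdef_def)
  then show ?thesis
    by (simp add: form_inverse_right[OF assms(2,3)])
qed

text \<open>Cauchy--Schwarz for the form of \<open>B\<close>, applied to \<open>w\<close> and \<open>s i\<close>.\<close>

lemma coord_square_le_form:
  assumes "posdef N B" "inverse_cols N B s" "i < N"
  shows "(w i)\<^sup>2 \<le> s i i * form N B w w"
proof -
  \<comment> \<open>This is \<open>s i i\<close> times the component of \<open>w\<close> orthogonal
    to \<open>s i\<close> with respect to the form.\<close>
  let ?u = "\<lambda>j. s i i * w j - w i * s i j"
  have "form N B ?u ?u = s i i * (s i i * form N B w w - (w i)\<^sup>2)"
    unfolding form_diff_left form_diff_right form_scale_left form_scale_right
        form_inverse_right[OF assms(2,3)] form_inverse_left[OF assms]
    by (simp add: power2_eq_square algebra_simps)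
  with form_self_nonneg[OF assms(1), of ?u] inverse_cols_diag_pos[OF assms] show ?thesis
    by (simp add: zero_le_mult_iff)
qed

text \<open>The coordinate bounds add up: the least eigenvalue of \<open>B\<close> is at least the
  reciprocal of the trace of its inverse. A trace of at most 1 therefore makes \<open>B\<close>
  dominate the identity.\<close>

lemma norm_square_le_trace_form:
  assumes "posdef N B" "inverse_cols N B s"
  shows "(\<Sum>i<N. (w i)\<^sup>2) \<le> (\<Sum>i<N. s i i) * form N B w w"
  unfolding sum_distrib_right
  by (rule sum_mono) (simp add: coord_square_le_form[OF assms])

text \<open>Positivity excludes a nonzero kernel vector, so the determinant does not vanish and the
  adjugate divided by it is the inverse.\<close>

lemma posdef_inverse_cols:
  assumes "posdef N B"
  obtains s where "inverse_cols N B s"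
proof -
  let ?A = "mat N N (\<lambda>(i, j). B i j)"
  have A: "?A \<in> carrier_mat N N" by simp
  have det: "det ?A \<noteq> 0"
  proof
    assume "det ?A = 0"
    then obtain v where v: "v \<in> carrier_vec N" "v \<noteq> 0\<^sub>v N" "?A *\<^sub>v v = 0\<^sub>v N"
      using det_0_iff_vec_prod_zero[OF A] by auto
    then obtain i where "i < N" "v $ i \<noteq> 0"
      by (metis carrier_vecD eq_vecI index_zero_vec(1,2))
    then have "0 < form N B (\<lambda>i. v $ i) (\<lambda>i. v $ i)"
      using assms by (auto simp: posdef_def)
    moreover have "(\<Sum>j<N. B k j * v $ j) = 0" if "k < N" for k
    proof -
      have "(?A *\<^sub>v v) $ k = (\<Sum>j<N. B k j * v $ j)"
        using that v(1) by (simp add: scalar_prod_def lessThan_atLeast0)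
      with v(3) that show ?thesis by simp
    qed
    then have "(\<Sum>i<N. v $ i * (\<Sum>j<N. B i j * v $ j)) = 0" by simp
    ultimately show False by (simp add: form_def sum_distrib_left mult.assoc)
  qed
  let ?S = "(1 / det ?A) \<cdot>\<^sub>m adj_mat ?A"
  have S: "?S \<in> carrier_mat N N" using adj_mat(1)[OF A] by simp
  have AS: "?A * ?S = 1\<^sub>m N"
    using adj_mat[OF A] det A by (simp add: mult_smult_distrib[OF A adj_mat(1)[OF A]]) (auto intro!: eq_matI)
  have "(\<Sum>j<N. B k j * ?S $$ (j, i)) = (if k = i then 1 else 0)" if "i < N" "k < N" for i k
  proof -
    have "(?A * ?S) $$ (k, i) = (\<Sum>j<N. B k j * ?S $$ (j, i))"
      using that S by (simp add: scalar_prod_def lessThan_atLeast0 del: index_smult_mat)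
    with AS that show ?thesis by simp
  qed
  then have "inverse_cols N B (\<lambda>i j. ?S $$ (j, i))"
    unfolding inverse_cols_def by blast
  then show ?thesis by (rule that)
qed


section \<open>Shifts by the identity and rank-one updates\<close>

lemma form_shift:
  "form N (\<lambda>i j. B i j - (if i = j then a else 0)) u w = form N B u w - a * (\<Sum>i<N. u i * w i)"
proof -
  have "(\<Sum>j<N. u i * (B i j - (if i = j then a else 0)) * w j)
      = (\<Sum>j<N. u i * B i j * w j) - a * (u i * w i)" if "i < N" for i
  proof -
    have "(\<Sum>j<N. u i * (B i j - (if i = j then a else 0)) * w j)
      = (\<Sum>j<N. u i * B i j * w j - (if i = j then a * (u i * w j) else 0))"
      by (intro sum.cong) (auto simp: algebra_simps)
    also have "\<dots> = (\<Sum>j<N. u i * B i j * w j) - a * (u i * w i)"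
      using that by (simp add: sum_subtractf)
    finally show ?thesis .
  qed
  then show ?thesis
    by (simp add: form_def sum_subtractf sum_distrib_left)
qed

lemma form_rank_one:
  "form N (\<lambda>i j. B i j + v i * v j) u w = form N B u w + (\<Sum>i<N. u i * v i) * (\<Sum>i<N. w i * v i)"
  by (simp add: form_def distrib_left distrib_right sum.distrib sum_product mult_ac)

lemma posdef_rank_one:
  assumes "posdef N B"
  shows "posdef N (\<lambda>i j. B i j + v i * v j)"
  using assms unfolding posdef_def form_rank_one
  by (auto simp: mult.commute intro!: add_pos_nonneg zero_le_square)

context
  fixes N :: nat and B C :: "nat \<Rightarrow> nat \<Rightarrow> real" and s :: "nat \<Rightarrow> nat \<Rightarrow> real"
  assumes B: "posdef N B" and s: "inverse_cols N B s" and trace_s: "(\<Sum>i<N. s i i) \<le> 1"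
  defines "C \<equiv> \<lambda>i j. B i j - (if i = j then 1/3 else 0)"
begin

lemma form_shift_third: "form N C u w = form N B u w - 1/3 * (\<Sum>i<N. u i * w i)"
  unfolding C_def by (rule form_shift)

text \<open>A trace of at most 1 bounds the squared Euclidean norm by the form of \<open>B\<close>,
  so removing a third of the identity costs at most a third of the form.\<close>

lemma form_shift_ge: "2/3 * form N B w w \<le> form N C w w"
proof -
  have "(\<Sum>i<N. w i * w i) \<le> (\<Sum>i<N. s i i) * form N B w w"
    using norm_square_le_trace_form[OF B s, of w] by (simp add: power2_eq_square)
  also have "\<dots> \<le> 1 * form N B w w"
    using trace_s form_self_nonneg[OF B] by (rule mult_right_mono)
  finally show ?thesis by (simp add: form_shift_third)
qed

lemma posdef_shift: "posdef N C"
  unfolding posdef_def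
proof (intro conjI allI impI)
  fix i j show "C i j = C j i"
    using B by (simp add: C_def posdef_def)
next
  fix w :: "nat \<Rightarrow> real" assume "\<exists>i<N. w i \<noteq> 0"
  then have "0 < form N B w w" using B by (simp add: posdef_def)
  with form_shift_ge[of w] show "0 < form N C w w" by linarith
qed

context
  fixes r :: "nat \<Rightarrow> nat \<Rightarrow> real"
  assumes r: "inverse_cols N C r"
begin

text \<open>Inversion reverses the order of forms, and \<open>C\<close> is at least two thirds of
  \<open>B\<close>. The coordinate bound for \<open>B\<close> is applied to \<open>r i\<close>,
  whose form under \<open>C\<close> is \<open>r i i\<close>.\<close>

lemma inverse_diag_shift_le: "i < N \<Longrightarrow> r i i \<le> 3/2 * s i i"
proof -
  assume i: "i < N"
  have pos: "0 < r i i" "0 < s i i"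
    using inverse_cols_diag_pos[OF posdef_shift r i] inverse_cols_diag_pos[OF B s i] .
  have "r i i * r i i \<le> s i i * form N B (r i) (r i)"
    using coord_square_le_form[OF B s i, of "r i"] by (simp add: power2_eq_square)
  also have "\<dots> \<le> s i i * (3/2 * form N C (r i) (r i))"
    using form_shift_ge[of "r i"] pos by (intro mult_left_mono) auto
  also have "form N C (r i) (r i) = r i i"
    by (rule form_inverse_right[OF r i])
  finally have "r i i * r i i \<le> (3/2 * s i i) * r i i" by (simp add: mult_ac)
  with pos show ?thesis by simp
qed

text \<open>The same comparison with the roles exchanged, from the fact that the form of
  \<open>C\<close> is at most that of \<open>B\<close>.\<close>

lemma inverse_diag_le_shift: "i < N \<Longrightarrow> s i i \<le> r i i"
proof -
  assume i: "i < N"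
  have pos: "0 < r i i" "0 < s i i"
    using inverse_cols_diag_pos[OF posdef_shift r i] inverse_cols_diag_pos[OF B s i] .
  have "s i i * s i i \<le> r i i * form N C (s i) (s i)"
    using coord_square_le_form[OF posdef_shift r i, of "s i"] by (simp add: power2_eq_square)
  also have "\<dots> \<le> r i i * form N B (s i) (s i)"
    using pos by (intro mult_left_mono) (auto simp: form_shift_third sum_nonneg)
  also have "form N B (s i) (s i) = s i i"
    by (rule form_inverse_right[OF s i])
  finally show ?thesis using pos by simp
qed

text \<open>The left side is the inner product of \<open>r i\<close> and \<open>s i\<close>. It
  falls short of the squared norm of \<open>r i\<close> by the inner product of \<open>r i\<close>
  with \<open>r i - s i\<close>, which is three times the form of \<open>B\<close> at
  \<open>r i - s i\<close>. Summed over \<open>i\<close>, this bounds the rise of the trace of the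
  inverse by a third of the squared Frobenius norm of the new inverse.\<close>

lemma inverse_diag_increment_le:
  assumes i: "i < N"
  shows "3 * (r i i - s i i) \<le> (\<Sum>j<N. (r i j)\<^sup>2)"
proof -
  let ?d = "\<lambda>j. r i j - s i j"
  \<comment> \<open>Resolvent identity: \<open>B\<close> maps \<open>?d\<close> to a third of
    \<open>r i\<close>.\<close>
  have d: "form N B ?d u = 1/3 * (\<Sum>j<N. r i j * u j)" for u
    using form_inverse_left[OF posdef_shift r i, of u] form_inverse_left[OF B s i, of u]
    by (simp add: form_diff_left form_shift_third)
  have "0 \<le> (\<Sum>j<N. r i j * ?d j)"
    using d[of ?d] form_self_nonneg[OF B, of ?d] by simp
  then have "(\<Sum>j<N. r i j * s i j) \<le> (\<Sum>j<N. (r i j)\<^sup>2)"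
    by (simp add: right_diff_distrib sum_subtractf power2_eq_square)
  moreover have "(\<Sum>j<N. r i j * s i j) = 3 * (r i i - s i i)"
    using d[of "s i"] form_inverse_right[OF s i, of ?d] by simp
  ultimately show ?thesis by simp
qed

end

end

text \<open>The Sherman--Morrison formula.\<close>

lemma inverse_cols_rank_one:
  fixes v :: "nat \<Rightarrow> real"
  assumes C: "posdef N C" and r: "inverse_cols N C r"
  defines "t \<equiv> \<lambda>i. \<Sum>j<N. r i j * v j"
  defines "q \<equiv> \<Sum>i<N. t i * v i"
  shows "0 \<le> q"
    and "inverse_cols N (\<lambda>i j. C i j + v i * v j) (\<lambda>i j. r i j - t i * t j / (1 + q))"
proof -
  \<comment> \<open>\<open>t\<close> is the inverse of \<open>C\<close> applied to \<open>v\<close>;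
    symmetry of the inverse lets its columns serve as rows.\<close>
  have Ct: "(\<Sum>j<N. C k j * t j) = v k" if k: "k < N" for k
  proof -
    have "(\<Sum>j<N. C k j * t j) = (\<Sum>j<N. \<Sum>l<N. C k j * (r j l * v l))"
      by (simp add: t_def sum_distrib_left)
    also have "\<dots> = (\<Sum>l<N. \<Sum>j<N. C k j * (r j l * v l))"
      by (rule sum.swap)
    also have "\<dots> = (\<Sum>l<N. v l * (\<Sum>j<N. C k j * r l j))"
      unfolding sum_distrib_left
      by (intro sum.cong refl) (simp add: inverse_cols_commute[OF C r])
    also have "\<dots> = (\<Sum>l<N. if k = l then v l else 0)"
      using r k by (intro sum.cong) (auto simp: inverse_cols_def)
    also have "\<dots> = v k" using k by simp
    finally show ?thesis .
  qed
  \<comment> \<open>As the form of \<open>C\<close> at \<open>t\<close>, \<open>q\<close> is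
    nonnegative, so division by \<open>1 + q\<close> is legitimate.\<close>
  have "form N C t t = (\<Sum>i<N. t i * (\<Sum>j<N. C i j * t j))"
    by (simp add: form_def sum_distrib_left mult.assoc)
  then have "form N C t t = q"
    by (simp add: Ct q_def)
  then show q: "0 \<le> q"
    using form_self_nonneg[OF C, of t] by simp
  have "(\<Sum>j<N. (C k j + v k * v j) * (r i j - t i * t j / (1 + q))) = (if k = i then 1 else 0)"
    if i: "i < N" and k: "k < N" for i k
  proof -
    have "(\<Sum>j<N. (C k j + v k * v j) * (r i j - t i * t j / (1 + q)))
      = (\<Sum>j<N. C k j * r i j) + v k * (\<Sum>j<N. r i j * v j)
          - t i / (1 + q) * (\<Sum>j<N. C k j * t j) - t i / (1 + q) * v k * (\<Sum>j<N. t j * v j)"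
      by (simp add: sum_distrib_left sum.distrib sum_subtractf add_divide_distrib sum_divide_distrib
          algebra_simps)
    also have "\<dots> = (if k = i then 1 else 0) + v k * t i - t i / (1 + q) * v k - t i / (1 + q) * v k * q"
    proof -
      have "(\<Sum>j<N. r i j * v j) = t i" "(\<Sum>j<N. t j * v j) = q"
        by (simp_all add: t_def q_def)
      with r i k show ?thesis by (simp add: Ct inverse_cols_def)
    qed
    \<comment> \<open>The two fractions combine into a multiple of \<open>(1 + q) / (1 + q)\<close>
      that cancels \<open>v k * t i\<close>.\<close>
    also have "\<dots> = (if k = i then 1 else 0) + v k * t i - t i * v k * ((1 + q) / (1 + q))"
      unfolding add_divide_distrib by (simp add: algebra_simps)
    finally show ?thesis using q by simp
  qed
  then show "inverse_cols N (\<lambda>i j. C i j + v i * v j) (\<lambda>i j. r i j - t i * t j / (1 + q))"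
    unfolding inverse_cols_def by blast
qed


section \<open>The barrier argument and the choice of points\<close>

text \<open>The trace of the inverse is the lower potential of Batson, Spielman and Srivastava. The
  barrier level is absorbed into \<open>B\<close>, so the potential is always taken at level
  0.\<close>

definition barrier :: "nat \<Rightarrow> (nat \<Rightarrow> nat \<Rightarrow> real) \<Rightarrow> bool" where
  "barrier N B \<longleftrightarrow> posdef N B \<and> (\<exists>s. inverse_cols N B s \<and> (\<Sum>i<N. s i i) \<le> 1)"

text \<open>Start of the iteration: the inverse of \<open>k\<close> times the identity has trace
  \<open>N / k\<close>, at most 1.\<close>

lemma barrier_scaled_identity:
  assumes "N \<le> k" "1 \<le> k"
  shows "barrier N (\<lambda>i j. if i = j then real k else 0)"
proof -
  let ?I = "\<lambda>i j. if i = j then real k else 0"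
  have form: "form N ?I w w = (\<Sum>i<N. real k * (w i)\<^sup>2)" for w
  proof -
    have "(\<Sum>j<N. w i * ?I i j * w j) = real k * (w i)\<^sup>2" if "i < N" for i
    proof -
      have "(\<Sum>j<N. w i * ?I i j * w j) = (\<Sum>j<N. if i = j then w i * real k * w j else 0)"
        by (intro sum.cong) auto
      with that show ?thesis by (simp add: power2_eq_square)
    qed
    then show ?thesis by (simp add: form_def)
  qed
  have "posdef N ?I"
    unfolding posdef_def form
  proof (intro conjI allI impI)
    fix w :: "nat \<Rightarrow> real" assume "\<exists>i<N. w i \<noteq> 0"
    then obtain i where "i < N" "w i \<noteq> 0" by blast
    then show "0 < (\<Sum>i<N. real k * (w i)\<^sup>2)"
      using assms by (intro sum_pos2[of _ i]) auto
  qed auto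
  moreover have "inverse_cols N ?I (\<lambda>i j. if i = j then 1 / real k else 0)"
    unfolding inverse_cols_def
  proof (intro allI impI)
    fix i h assume "i < N" "h < N"
    have "(\<Sum>j<N. ?I h j * (if i = j then 1 / real k else 0))
        = (\<Sum>j<N. if h = j then (if h = i then 1 else 0) else 0)"
      using assms by (intro sum.cong) auto
    then show "(\<Sum>j<N. ?I h j * (if i = j then 1 / real k else 0)) = (if h = i then 1 else 0)"
      using \<open>h < N\<close> by simp
  qed
  moreover have "(\<Sum>i<N. if i = i then 1 / real k else 0) \<le> 1"
    using assms by simp
  ultimately show ?thesis
    unfolding barrier_def by (intro conjI exI[of _ "\<lambda>i j. if i = j then 1 / real k else 0"])
qed

text \<open>\<open>has_bochner_integral\<close> supplies the integrability of the products together
  with their integrals.\<close>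

definition orthonormal :: "'a measure \<Rightarrow> nat \<Rightarrow> (nat \<Rightarrow> 'a \<Rightarrow> real) \<Rightarrow> bool" where
  "orthonormal M N v \<longleftrightarrow> (\<forall>i<N. \<forall>j<N.
     has_bochner_integral M (\<lambda>x. v i x * v j x) (if i = j then 1 else 0))"

text \<open>Parseval's identity. It yields the averages in the barrier argument and, later, the norm
  of an element of the span.\<close>

lemma has_bochner_integral_orthonormal:
  assumes "orthonormal M N v"
  shows "has_bochner_integral M (\<lambda>x. (\<Sum>i<N. a i * v i x) * (\<Sum>j<N. b j * v j x)) (\<Sum>i<N. a i * b i)"
proof -
  have "has_bochner_integral M (\<lambda>x. \<Sum>i<N. \<Sum>j<N. a i * b j * (v i x * v j x))
      (\<Sum>i<N. \<Sum>j<N. a i * b j * (if i = j then 1 else 0))"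
    using assms unfolding orthonormal_def
    by (intro has_bochner_integral_sum has_bochner_integral_mult_right) auto
  also have "(\<lambda>x. \<Sum>i<N. \<Sum>j<N. a i * b j * (v i x * v j x))
      = (\<lambda>x. (\<Sum>i<N. a i * v i x) * (\<Sum>j<N. b j * v j x))"
    by (simp add: sum_product mult_ac)
  also have "(\<Sum>i<N. \<Sum>j<N. a i * b j * (if i = j then 1 else 0)) = (\<Sum>i<N. a i * b i)"
  proof (intro sum.cong refl)
    fix i assume "i \<in> {..<N}"
    have "(\<Sum>j<N. a i * b j * (if i = j then 1 else 0)) = (\<Sum>j<N. if i = j then a i * b j else 0)"
      by (intro sum.cong) auto
    with \<open>i \<in> {..<N}\<close> show "(\<Sum>j<N. a i * b j * (if i = j then 1 else 0)) = a i * b i"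
      by simp
  qed
  finally show ?thesis .
qed

text \<open>The shift raises the trace of the inverse by \<open>p\<close>; by the Sherman--Morrison
  formula the rank-one term lowers it by the squared norm of \<open>t x\<close> divided by
  \<open>1 + q x\<close>. The function \<open>h\<close> compares the two and has nonnegative mean,
  so it cannot be negative almost everywhere. Hence some point with \<open>P\<close> has
  \<open>h\<close> nonnegative.\<close>

lemma (in prob_space) barrier_step:
  assumes v: "orthonormal M N v" and P: "AE x in M. P x" and B: "barrier N B"
  shows "\<exists>x\<in>space M. P x \<and>
    barrier N (\<lambda>i j. B i j - (if i = j then 1/3 else 0) + v i x * v j x)"
proof -
  from B obtain s where B: "posdef N B" and s: "inverse_cols N B s" and trace_s: "(\<Sum>i<N. s i i) \<le> 1"
    unfolding barrier_def by blast
  define C where "C = (\<lambda>i j. B i j - (if i = j then 1/3 else 0))"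
  have C: "posdef N C"
    using posdef_shift[OF B s trace_s] by (simp add: C_def)
  obtain r where r: "inverse_cols N C r"
    using posdef_inverse_cols[OF C] .
  note r' = r[unfolded C_def]
  \<comment> \<open>\<open>t x\<close> is the inverse of \<open>C\<close> applied to the vector of
    the values \<open>v j x\<close>, and \<open>q x\<close> is its inner product with that
    vector.\<close>
  define t where "t = (\<lambda>x i. \<Sum>j<N. r i j * v j x)"
  define q where "q = (\<lambda>x. \<Sum>i<N. t x i * v i x)"
  define p where "p = (\<Sum>i<N. r i i) - (\<Sum>i<N. s i i)"
  define h where "h = (\<lambda>x. (\<Sum>i<N. (t x i)\<^sup>2) - p * (1 + q x))"
  have "(\<Sum>i<N. s i i) \<le> (\<Sum>i<N. r i i)"
    using inverse_diag_le_shift[OF B s trace_s r'] by (intro sum_mono) auto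
  then have p0: "0 \<le> p"
    by (simp add: p_def)
  have "(\<Sum>i<N. r i i) \<le> (\<Sum>i<N. 3/2 * s i i)"
    using inverse_diag_shift_le[OF B s trace_s r'] by (intro sum_mono) auto
  also have "\<dots> = 3/2 * (\<Sum>i<N. s i i)"
    by (rule sum_distrib_left[symmetric])
  finally have trace_r: "(\<Sum>i<N. r i i) \<le> 3/2"
    using trace_s by linarith
  have "3 * p = (\<Sum>i<N. 3 * (r i i - s i i))"
    by (simp add: p_def sum_subtractf flip: sum_distrib_left)
  also have "\<dots> \<le> (\<Sum>i<N. \<Sum>j<N. (r i j)\<^sup>2)"
    using inverse_diag_increment_le[OF B s trace_s r'] by (intro sum_mono) auto
  finally have norm_r: "3 * p \<le> (\<Sum>i<N. \<Sum>j<N. r i j * r i j)"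
    by (simp add: power2_eq_square)
  have "has_bochner_integral M (\<lambda>x. t x i * v i x) (r i i)" if i: "i < N" for i
  proof -
    have "has_bochner_integral M
        (\<lambda>x. (\<Sum>j<N. r i j * v j x) * (\<Sum>j<N. (if i = j then 1 else 0) * v j x))
        (\<Sum>j<N. r i j * (if i = j then 1 else 0))"
      by (rule has_bochner_integral_orthonormal[OF v])
    moreover have "(\<Sum>j<N. (if i = j then 1 else 0) * v j x) = v i x" for x
    proof -
      have "(\<Sum>j<N. (if i = j then 1 else 0) * v j x) = (\<Sum>j<N. if i = j then v j x else 0)"
        by (intro sum.cong) auto
      with i show ?thesis by simp
    qed
    moreover have "(\<Sum>j<N. r i j * (if i = j then 1 else 0)) = r i i"
    proof -
      have "(\<Sum>j<N. r i j * (if i = j then 1 else 0)) = (\<Sum>j<N. if i = j then r i j else 0)"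
        by (intro sum.cong) auto
      with i show ?thesis by simp
    qed
    ultimately show ?thesis by (simp add: t_def)
  qed
  then have q: "has_bochner_integral M q (\<Sum>i<N. r i i)"
    unfolding q_def by (intro has_bochner_integral_sum) auto
  have one: "has_bochner_integral M (\<lambda>x. 1) (1::real)"
    by (simp add: has_bochner_integral_iff prob_space)
  have "has_bochner_integral M (\<lambda>x. \<Sum>i<N. t x i * t x i) (\<Sum>i<N. \<Sum>j<N. r i j * r i j)"
    unfolding t_def by (intro has_bochner_integral_sum has_bochner_integral_orthonormal[OF v])
  then have h: "has_bochner_integral M h
      ((\<Sum>i<N. \<Sum>j<N. r i j * r i j) - p * (1 + (\<Sum>i<N. r i i)))"
    unfolding h_def power2_eq_square
    by (intro has_bochner_integral_diff has_bochner_integral_mult_right has_bochner_integral_add one q)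
  \<comment> \<open>The shift 1/3 fits here: it gives the factor 3 in \<open>norm_r\<close> and the
    trace bound 3/2, and \<open>1 + 3/2\<close> is below 3.\<close>
  have "p * (1 + (\<Sum>i<N. r i i)) \<le> p * 3"
    using p0 trace_r by (intro mult_left_mono) auto
  with norm_r have int_h: "0 \<le> (\<integral>x. h x \<partial>M)"
    using has_bochner_integral_integral_eq[OF h] by simp
  have "\<exists>x\<in>space M. P x \<and> 0 \<le> h x"
  proof (rule ccontr)
    assume "\<not> ?thesis"
    with P have "AE x in M. h x < 0" by (auto intro: AE_mp simp: not_le)
    then have "(\<integral>x. h x \<partial>M) < (\<integral>x. 0 \<partial>M)"
      using has_bochner_integral_iff[THEN iffD1, OF h] emeasure_space_1
      by (intro integral_less_AE_space) auto
    with int_h show False by simp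
  qed
  then obtain x where x: "x \<in> space M" "P x" "0 \<le> h x" by blast
  note rank_one = inverse_cols_rank_one[OF C r, of "\<lambda>j. v j x"]
  have q0: "0 \<le> q x"
    using rank_one(1) by (simp add: q_def t_def)
  have "inverse_cols N (\<lambda>i j. C i j + v i x * v j x) (\<lambda>i j. r i j - t x i * t x j / (1 + q x))"
    using rank_one(2) by (simp add: q_def t_def)
  moreover have "(\<Sum>i<N. r i i - t x i * t x i / (1 + q x)) \<le> 1"
  proof -
    have "p \<le> (\<Sum>i<N. (t x i)\<^sup>2) / (1 + q x)"
      using x(3) q0 by (simp add: h_def pos_le_divide_eq)
    then show ?thesis
      using trace_s by (simp add: p_def sum_subtractf power2_eq_square sum_divide_distrib)
  qed
  moreover have "posdef N (\<lambda>i j. C i j + v i x * v j x)"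
    by (rule posdef_rank_one[OF C])
  ultimately have "barrier N (\<lambda>i j. C i j + v i x * v j x)"
    unfolding barrier_def by blast
  with x show ?thesis by (auto simp: C_def)
qed

text \<open>Each step subtracts a third of the identity and adds the rank-one matrix of a new point,
  starting from \<open>k\<close> times the identity at \<open>m = 0\<close>.\<close>

lemma (in prob_space) barrier_points:
  assumes v: "orthonormal M N v" and P: "AE x in M. P x" and k: "N \<le> k" "1 \<le> k"
  shows "\<exists>\<xi>. (\<forall>l<m. \<xi> l \<in> space M \<and> P (\<xi> l)) \<and>
    barrier N (\<lambda>i j. (\<Sum>l<m. v i (\<xi> l) * v j (\<xi> l)) - (if i = j then real m / 3 - real k else 0))"
proof (induction m)
  case 0
  have "(\<lambda>i j. (\<Sum>l<0. v i (\<xi> l) * v j (\<xi> l)) - (if i = j then real 0 / 3 - real k else 0))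
      = (\<lambda>i j. if i = j then real k else 0)" for \<xi> :: "nat \<Rightarrow> 'a"
    by (intro ext) simp
  then show ?case
    using barrier_scaled_identity[OF k] by simp
next
  case (Suc m)
  then obtain \<xi> where \<xi>: "\<forall>l<m. \<xi> l \<in> space M \<and> P (\<xi> l)" and
    B: "barrier N (\<lambda>i j. (\<Sum>l<m. v i (\<xi> l) * v j (\<xi> l)) - (if i = j then real m / 3 - real k else 0))"
    by blast
  from barrier_step[OF v P B] obtain x where x: "x \<in> space M" "P x" and
    B': "barrier N (\<lambda>i j. (\<Sum>l<m. v i (\<xi> l) * v j (\<xi> l))
      - (if i = j then real m / 3 - real k else 0) - (if i = j then 1/3 else 0) + v i x * v j x)"
    by blast
  let ?\<xi> = "\<xi>(m := x)"
  have "(\<Sum>l<m. v i (?\<xi> l) * v j (?\<xi> l)) = (\<Sum>l<m. v i (\<xi> l) * v j (\<xi> l))" for i j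
    by (intro sum.cong) auto
  then have eq: "(\<lambda>i j. (\<Sum>l<m. v i (\<xi> l) * v j (\<xi> l))
      - (if i = j then real m / 3 - real k else 0) - (if i = j then 1/3 else 0) + v i x * v j x)
    = (\<lambda>i j. (\<Sum>l<Suc m. v i (?\<xi> l) * v j (?\<xi> l)) - (if i = j then real (Suc m) / 3 - real k else 0))"
    by (intro ext) (simp add: add_divide_distrib)
  show ?case
    by (intro exI[of _ ?\<xi>] conjI B'[unfolded eq]) (use \<xi> x in \<open>auto simp: less_Suc_eq\<close>)
qed

lemma form_gram:
  "form N (\<lambda>i j. \<Sum>l<m. E l i * E l j) w w = (\<Sum>l<m. (\<Sum>i<N. w i * E l i)\<^sup>2)"
proof -
  have "form N (\<lambda>i j. \<Sum>l<m. E l i * E l j) w w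
      = (\<Sum>i<N. \<Sum>j<N. \<Sum>l<m. (w i * E l i) * (w j * E l j))"
    by (simp add: form_def sum_distrib_left sum_distrib_right mult_ac)
  also have "\<dots> = (\<Sum>i<N. \<Sum>l<m. \<Sum>j<N. (w i * E l i) * (w j * E l j))"
    by (intro sum.cong refl sum.swap)
  also have "\<dots> = (\<Sum>l<m. \<Sum>i<N. \<Sum>j<N. (w i * E l i) * (w j * E l j))"
    by (rule sum.swap)
  finally show ?thesis
    by (simp add: power2_eq_square sum_product)
qed

text \<open>After \<open>6 * k\<close> steps the level \<open>m / 3 - k\<close> equals
  \<open>k\<close>, and nonnegativity of the final form is the lower bound.\<close>

lemma (in prob_space) discretization_points:
  assumes v: "orthonormal M N v" and P: "AE x in M. P x" and k: "N \<le> k" "1 \<le> k"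
  obtains \<xi> where "\<And>l. l < 6 * k \<Longrightarrow> \<xi> l \<in> space M" "\<And>l. l < 6 * k \<Longrightarrow> P (\<xi> l)"
    "\<And>w. real k * (\<Sum>i<N. (w i)\<^sup>2) \<le> (\<Sum>l<6*k. (\<Sum>i<N. w i * v i (\<xi> l))\<^sup>2)"
proof -
  obtain \<xi> where \<xi>: "\<forall>l<6*k. \<xi> l \<in> space M \<and> P (\<xi> l)" and
    B: "barrier N (\<lambda>i j. (\<Sum>l<6*k. v i (\<xi> l) * v j (\<xi> l))
          - (if i = j then real (6 * k) / 3 - real k else 0))"
    using barrier_points[OF v P k, of "6 * k"] by blast
  have "real k * (\<Sum>i<N. (w i)\<^sup>2) \<le> (\<Sum>l<6*k. (\<Sum>i<N. w i * v i (\<xi> l))\<^sup>2)" for w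
    using form_self_nonneg[OF B[unfolded barrier_def, THEN conjunct1], of w]
    unfolding form_shift form_gram[where E = "\<lambda>l i. v i (\<xi> l)"]
    by (simp add: power2_eq_square)
  with \<xi> show ?thesis by (intro that[of \<xi>]) auto
qed

section \<open>Least squares on the sample\<close>

text \<open>\<open>T\<close> is the pseudoinverse of the sample matrix \<open>E\<close>, so the
  fitted coefficients depend linearly on \<open>y\<close>. The bound is Pythagoras: the residual
  \<open>z\<close> of the best fit is orthogonal to the difference \<open>u\<close> of the two fits,
  so \<open>u\<close> is no longer than \<open>z - u\<close>, the residual of
  \<open>c\<close>.\<close>

lemma least_squares:
  fixes E :: "nat \<Rightarrow> nat \<Rightarrow> real"
  assumes k: "0 < k" and E: "\<And>w. k * (\<Sum>i<N. (w i)\<^sup>2) \<le> (\<Sum>l<m. (\<Sum>i<N. w i * E l i)\<^sup>2)"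
  obtains T where "\<And>y c. k * (\<Sum>i<N. (c i - (\<Sum>l<m. T i l * y l))\<^sup>2)
      \<le> (\<Sum>l<m. (y l - (\<Sum>i<N. c i * E l i))\<^sup>2)"
proof -
  let ?G = "\<lambda>i j. \<Sum>l<m. E l i * E l j"
  have G: "posdef N ?G"
    unfolding posdef_def form_gram
  proof (intro conjI allI impI)
    fix i j show "?G i j = ?G j i" by (simp add: mult.commute)
  next
    fix w :: "nat \<Rightarrow> real" assume "\<exists>i<N. w i \<noteq> 0"
    then obtain i where "i < N" "w i \<noteq> 0" by blast
    then have "0 < k * (\<Sum>i<N. (w i)\<^sup>2)"
      using k by (intro mult_pos_pos sum_pos2[of _ i]) auto
    with E[of w] show "0 < (\<Sum>l<m. (\<Sum>i<N. w i * E l i)\<^sup>2)" by linarith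
  qed
  obtain g where g: "inverse_cols N ?G g"
    using posdef_inverse_cols[OF G] .
  \<comment> \<open>The inverse of \<open>?G\<close> times the transpose of the sample
    matrix.\<close>
  define T where "T = (\<lambda>i l. \<Sum>h<N. g h i * E l h)"
  have "k * (\<Sum>i<N. (c i - (\<Sum>l<m. T i l * y l))\<^sup>2) \<le> (\<Sum>l<m. (y l - (\<Sum>i<N. c i * E l i))\<^sup>2)" for y c
  proof -
    define c' where "c' = (\<lambda>i. \<Sum>l<m. T i l * y l)"
    define z where "z = (\<lambda>l. y l - (\<Sum>i<N. c' i * E l i))"
    define u where "u = (\<lambda>l. \<Sum>i<N. (c i - c' i) * E l i)"
    have c': "c' i = (\<Sum>h<N. g h i * (\<Sum>l<m. E l h * y l))" for i
      unfolding c'_def T_def sum_distrib_left sum_distrib_right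
      by (subst sum.swap) (simp add: mult_ac)
    \<comment> \<open>Normal equations: the residual is orthogonal to every column of the sample
      matrix.\<close>
    have normal: "(\<Sum>l<m. E l h * z l) = 0" if h: "h < N" for h
    proof -
      have "(\<Sum>l<m. E l h * (\<Sum>i<N. c' i * E l i)) = (\<Sum>i<N. ?G h i * c' i)"
        unfolding sum_distrib_left sum_distrib_right
        by (subst sum.swap) (simp add: mult_ac)
      also have "\<dots> = (\<Sum>i<N. \<Sum>j<N. ?G h i * g j i * (\<Sum>l<m. E l j * y l))"
        unfolding c' sum_distrib_left[of "?G _ _"] by (simp only: mult.assoc)
      also have "\<dots> = (\<Sum>j<N. (\<Sum>i<N. ?G h i * g j i) * (\<Sum>l<m. E l j * y l))"
        unfolding sum_distrib_right[of _ _ "\<Sum>l<m. E l _ * y l"] by (rule sum.swap)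
      also have "\<dots> = (\<Sum>j<N. if h = j then \<Sum>l<m. E l j * y l else 0)"
        using g h unfolding inverse_cols_def by (intro sum.cong) auto
      also have "\<dots> = (\<Sum>l<m. E l h * y l)"
        using h by simp
      finally show ?thesis
        by (simp add: z_def right_diff_distrib sum_subtractf)
    qed
    have "(\<Sum>l<m. u l * z l) = (\<Sum>i<N. (c i - c' i) * (\<Sum>l<m. E l i * z l))"
      unfolding u_def sum_distrib_left sum_distrib_right
      by (subst sum.swap) (simp add: mult_ac)
    then have orth: "(\<Sum>l<m. u l * z l) = 0" by (simp add: normal)
    have "k * (\<Sum>i<N. (c i - c' i)\<^sup>2) \<le> (\<Sum>l<m. (u l)\<^sup>2)"
      unfolding u_def by (rule E)
    also have "\<dots> \<le> (\<Sum>l<m. (u l)\<^sup>2) + (\<Sum>l<m. (z l)\<^sup>2) - 2 * (\<Sum>l<m. u l * z l)"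
      by (simp add: orth sum_nonneg)
    also have "\<dots> = (\<Sum>l<m. (z l - u l)\<^sup>2)"
      by (simp add: power2_diff sum.distrib sum_subtractf sum_distrib_left mult_ac)
    also have "\<dots> = (\<Sum>l<m. (y l - (\<Sum>i<N. c i * E l i))\<^sup>2)"
      by (simp add: z_def u_def left_diff_distrib sum_subtractf)
    finally show ?thesis by (simp add: c'_def)
  qed
  then show ?thesis by (rule that)
qed

section \<open>Square-integrable real functions and Gram--Schmidt\<close>

text \<open>The real counterpart of \<open>L2\<close>, to which real and imaginary parts of complex
  functions will belong.\<close>

definition square_integrable :: "'a measure \<Rightarrow> ('a \<Rightarrow> real) \<Rightarrow> bool" where
  "square_integrable M f \<longleftrightarrow> f \<in> borel_measurable M \<and> integrable M (\<lambda>x. (f x)\<^sup>2)"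

lemma square_integrable_mult:
  assumes "square_integrable M f" "square_integrable M g"
  shows "integrable M (\<lambda>x. f x * g x)"
proof (rule Bochner_Integration.integrable_bound)
  show "integrable M (\<lambda>x. (f x)\<^sup>2 + (g x)\<^sup>2)" "(\<lambda>x. f x * g x) \<in> borel_measurable M"
    using assms by (auto simp: square_integrable_def)
  have "\<bar>f x * g x\<bar> \<le> (f x)\<^sup>2 + (g x)\<^sup>2" for x
  proof -
    have "0 \<le> (\<bar>f x\<bar> - \<bar>g x\<bar>)\<^sup>2" by simp
    then have "2 * \<bar>f x * g x\<bar> \<le> (f x)\<^sup>2 + (g x)\<^sup>2"
      by (simp add: power2_diff abs_mult)
    then show ?thesis using abs_ge_zero[of "f x * g x"] by linarith
  qed
  then show "AE x in M. norm (f x * g x) \<le> norm ((f x)\<^sup>2 + (g x)\<^sup>2)" by simp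
qed

lemma square_integrable_scale:
  "square_integrable M f \<Longrightarrow> square_integrable M (\<lambda>x. a * f x)"
  by (auto simp: square_integrable_def power_mult_distrib)

lemma square_integrable_add:
  assumes "square_integrable M f" "square_integrable M g"
  shows "square_integrable M (\<lambda>x. f x + g x)"
proof -
  have "(\<lambda>x. (f x + g x)\<^sup>2) = (\<lambda>x. (f x)\<^sup>2 + (g x)\<^sup>2 + 2 * (f x * g x))"
    by (simp add: power2_sum fun_eq_iff)
  moreover have "integrable M (\<lambda>x. (f x)\<^sup>2 + (g x)\<^sup>2 + 2 * (f x * g x))"
    using assms square_integrable_mult[OF assms] unfolding square_integrable_def
    by (intro Bochner_Integration.integrable_add integrable_mult_right) auto
  ultimately show ?thesis
    using assms by (auto simp: square_integrable_def)
qed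

lemma square_integrable_diff:
  assumes "square_integrable M f" "square_integrable M g"
  shows "square_integrable M (\<lambda>x. f x - g x)"
  using square_integrable_add[OF assms(1) square_integrable_scale[OF assms(2), of "-1"]] by simp

lemma square_integrable_sum:
  assumes "\<And>i. i < (n::nat) \<Longrightarrow> square_integrable M (f i)"
  shows "square_integrable M (\<lambda>x. \<Sum>i<n. f i x)"
  using assms
proof (induction n)
  case 0
  show ?case by (simp add: square_integrable_def)
next
  case (Suc n)
  then show ?case by (simp add: square_integrable_add)
qed

text \<open>A function that depends on its predecessors up to a null set contributes no new element,
  so \<open>N\<close> may be smaller than \<open>n\<close>. The expansion holds almost everywhere;
  sample points are later chosen where it holds.\<close>

lemma Gram_Schmidt_AE:
  assumes "\<And>i. i < n \<Longrightarrow> square_integrable M (w i)"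
  shows "\<exists>N v T. N \<le> n \<and> (\<forall>i<N. square_integrable M (v i)) \<and> orthonormal M N v \<and>
    (AE x in M. \<forall>i<n. w i x = (\<Sum>j<N. T i j * v j x))"
  using assms
proof (induction n)
  case 0
  have "AE x in M. \<forall>i<0. w i x = (\<Sum>j<0. (\<lambda>i j. 0) i j * w j x)" by simp
  then show ?case
    by (intro exI[of _ 0] exI[of _ w] exI[of _ "\<lambda>i j. 0"]) (simp add: orthonormal_def)
next
  case (Suc n)
  have "\<And>i. i < n \<Longrightarrow> square_integrable M (w i)" using Suc.prems by simp
  from Suc.IH[OF this] obtain N v T where N: "N \<le> n" and v: "\<And>i. i < N \<Longrightarrow> square_integrable M (v i)" and
    orth: "orthonormal M N v" and T: "AE x in M. \<forall>i<n. w i x = (\<Sum>j<N. T i j * v j x)"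
    by blast
  have w: "square_integrable M (w n)" using Suc.prems by simp
  \<comment> \<open>Fourier coefficients of \<open>w n\<close>; \<open>d\<close> is what remains
    after projection onto the span found so far.\<close>
  define a where "a = (\<lambda>j. \<integral>x. w n x * v j x \<partial>M)"
  define d where "d = (\<lambda>x. w n x - (\<Sum>j<N. a j * v j x))"
  define \<nu> where "\<nu> = (\<integral>x. (d x)\<^sup>2 \<partial>M)"
  have d: "square_integrable M d"
    unfolding d_def by (intro square_integrable_diff w square_integrable_sum square_integrable_scale v)
  have d_orth: "has_bochner_integral M (\<lambda>x. d x * v i x) 0" if i: "i < N" for i
  proof -
    have "has_bochner_integral M (\<lambda>x. w n x * v i x - (\<Sum>j<N. a j * (v j x * v i x)))
        (a i - (\<Sum>j<N. a j * (if j = i then 1 else 0)))"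
      using orth i square_integrable_mult[OF w v[OF i]] unfolding orthonormal_def
      by (intro has_bochner_integral_diff has_bochner_integral_sum has_bochner_integral_mult_right)
        (auto simp: a_def has_bochner_integral_integrable)
    moreover have "(\<Sum>j<N. a j * (if j = i then 1 else 0)) = (\<Sum>j<N. if j = i then a j else 0)"
      by (intro sum.cong) auto
    ultimately show ?thesis
      using i by (simp add: d_def left_diff_distrib sum_distrib_right mult.assoc)
  qed
  show ?case
  \<comment> \<open>If \<open>d\<close> vanishes almost everywhere, the old system suffices;
    otherwise the normalized \<open>d\<close> is appended.\<close>
  proof (cases "\<nu> = 0")
    case True
    then have "AE x in M. (d x)\<^sup>2 = 0"
      using d integral_nonneg_eq_0_iff_AE[of M "\<lambda>x. (d x)\<^sup>2"] by (simp add: \<nu>_def square_integrable_def)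
    with T have "AE x in M. \<forall>i<Suc n. w i x = (\<Sum>j<N. (if i = n then a j else T i j) * v j x)"
      by eventually_elim (auto simp: d_def less_Suc_eq)
    with N v orth show ?thesis
      by (intro exI[of _ N] exI[of _ v] exI[of _ "\<lambda>i j. if i = n then a j else T i j"]) auto
  next
    case False
    then have \<nu>: "0 < \<nu>"
      by (simp add: \<nu>_def order_less_le)
    define v' where "v' = v(N := \<lambda>x. d x / sqrt \<nu>)"
    \<comment> \<open>\<open>T\<close> is arbitrary from column \<open>N\<close> on, so earlier rows
      are padded with 0. Row \<open>n\<close> has \<open>sqrt \<nu>\<close> in column
      \<open>N\<close>, since \<open>d\<close> is that multiple of the new element.\<close>
    define T' where "T' = (\<lambda>i j. if i = n then (if j < N then a j else sqrt \<nu>)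
      else if j < N then T i j else 0)"
    have vN: "square_integrable M (\<lambda>x. d x / sqrt \<nu>)"
      using square_integrable_scale[OF d, of "1 / sqrt \<nu>"] by simp
    have *: "has_bochner_integral M (\<lambda>x. d x / sqrt \<nu> * v i x) 0" if "i < N" for i
    proof -
      have "has_bochner_integral M (\<lambda>x. 1 / sqrt \<nu> * (d x * v i x)) (1 / sqrt \<nu> * 0)"
        by (intro has_bochner_integral_mult_right d_orth that)
      then show ?thesis by simp
    qed
    have "has_bochner_integral M (\<lambda>x. (d x)\<^sup>2) \<nu>"
      using d by (simp add: \<nu>_def square_integrable_def has_bochner_integral_integrable)
    then have "has_bochner_integral M (\<lambda>x. 1 / \<nu> * (d x)\<^sup>2) (1 / \<nu> * \<nu>)"
      by (intro has_bochner_integral_mult_right)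
    then have **: "has_bochner_integral M (\<lambda>x. d x / sqrt \<nu> * (d x / sqrt \<nu>)) 1"
      using \<nu> by (simp add: power2_eq_square)
    have "orthonormal M (Suc N) v'"
      unfolding orthonormal_def
    proof (intro allI impI)
      fix i j assume "i < Suc N" "j < Suc N"
      then consider "i = N" "j = N" | "i = N" "j < N" | "i < N" "j = N" | "i < N" "j < N"
        by linarith
      then show "has_bochner_integral M (\<lambda>x. v' i x * v' j x) (if i = j then 1 else 0)"
      proof cases
        case 1
        then show ?thesis using ** by (simp add: v'_def)
      next
        case 2
        then show ?thesis using *[of j] by (simp add: v'_def)
      next
        case 3
        then show ?thesis using *[of i] by (simp add: v'_def mult.commute)
      next
        case 4
        then show ?thesis using orth by (simp add: v'_def orthonormal_def)
      qed
    qed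
    moreover have "AE x in M. \<forall>i<Suc n. w i x = (\<Sum>j<Suc N. T' i j * v' j x)"
      using T
    proof eventually_elim
      case (elim x)
      show ?case
      proof (intro allI impI)
        fix i assume "i < Suc n"
        have "(\<Sum>j<N. T' i j * v' j x) = (\<Sum>j<N. (if i = n then a j else T i j) * v j x)"
          by (intro sum.cong) (auto simp: T'_def v'_def)
        with elim \<open>i < Suc n\<close> \<nu> show "w i x = (\<Sum>j<Suc N. T' i j * v' j x)"
          by (auto simp: T'_def v'_def d_def less_Suc_eq)
      qed
    qed
    moreover have "\<forall>i<Suc N. square_integrable M (v' i)"
      using v vN by (auto simp: v'_def less_Suc_eq)
    ultimately show ?thesis
      using N by (intro exI[of _ "Suc N"] exI[of _ v'] exI[of _ T']) auto
  qed
qed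

section \<open>Recovery of real functions from samples\<close>

text \<open>With \<open>g\<close> the combination of the \<open>w i\<close> with coefficients
  \<open>c\<close>, the error is almost everywhere \<open>f - g\<close> plus an element
  \<open>e\<close> of the span. The norm of \<open>e\<close> is a distance of coefficient vectors,
  which least squares bounds by the values of \<open>f - g\<close> at the sample points. The points
  and \<open>\<psi>\<close> are fixed before \<open>f\<close> and \<open>c\<close>.\<close>

lemma (in prob_space) linear_recovery:
  assumes w: "\<And>i. i < k \<Longrightarrow> square_integrable M (w i)" and k: "1 \<le> k"
  obtains \<xi> \<psi> where "\<And>l. l < 6 * k \<Longrightarrow> \<xi> l \<in> space M"
    and "\<And>l. square_integrable M (\<psi> l)"
    and "\<And>f c. square_integrable M f \<Longrightarrow>
      (\<integral>x. (f x - (\<Sum>l<6*k. f (\<xi> l) * \<psi> l x))\<^sup>2 \<partial>M)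
      \<le> 2 * (\<integral>x. (f x - (\<Sum>i<k. c i * w i x))\<^sup>2 \<partial>M)
        + 2 / real k * (\<Sum>l<6*k. (f (\<xi> l) - (\<Sum>i<k. c i * w i (\<xi> l)))\<^sup>2)"
proof -
  obtain N v T where N: "N \<le> k" and v: "\<And>i. i < N \<Longrightarrow> square_integrable M (v i)"
    and orth: "orthonormal M N v"
    and T: "AE x in M. \<forall>i<k. w i x = (\<Sum>j<N. T i j * v j x)"
    using Gram_Schmidt_AE[of k M w, OF w] by blast
  \<comment> \<open>The expansion \<open>T\<close> is taken as the almost sure property of the
    points, so that it holds exactly at each of them.\<close>
  obtain \<xi> where \<xi>: "\<And>l. l < 6 * k \<Longrightarrow> \<xi> l \<in> space M"
    and T\<xi>: "\<And>l. l < 6 * k \<Longrightarrow> \<forall>i<k. w i (\<xi> l) = (\<Sum>j<N. T i j * v j (\<xi> l))"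
    and lower: "\<And>a. real k * (\<Sum>i<N. (a i)\<^sup>2) \<le> (\<Sum>l<6*k. (\<Sum>i<N. a i * v i (\<xi> l))\<^sup>2)"
    using discretization_points[OF orth T N k] by blast
  obtain S where S: "\<And>y a. real k * (\<Sum>i<N. (a i - (\<Sum>l<6*k. S i l * y l))\<^sup>2)
      \<le> (\<Sum>l<6*k. (y l - (\<Sum>i<N. a i * v i (\<xi> l)))\<^sup>2)"
  proof (rule least_squares[where k = "real k" and N = N and m = "6 * k" and E = "\<lambda>l i. v i (\<xi> l)"])
    show "0 < real k" using k by simp
  qed (use lower in blast)+
  \<comment> \<open>\<open>\<psi> l\<close> is the least squares answer to the \<open>l\<close>-th
    unit sample.\<close>
  define \<psi> where "\<psi> = (\<lambda>l x. \<Sum>i<N. S i l * v i x)"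
  have \<psi>: "square_integrable M (\<psi> l)" for l
    unfolding \<psi>_def by (intro square_integrable_sum square_integrable_scale v)
  have "(\<integral>x. (f x - (\<Sum>l<6*k. f (\<xi> l) * \<psi> l x))\<^sup>2 \<partial>M)
      \<le> 2 * (\<integral>x. (f x - (\<Sum>i<k. c i * w i x))\<^sup>2 \<partial>M)
        + 2 / real k * (\<Sum>l<6*k. (f (\<xi> l) - (\<Sum>i<k. c i * w i (\<xi> l)))\<^sup>2)"
    if f: "square_integrable M f" for f c
  proof -
    define a where "a = (\<lambda>j. \<Sum>i<k. c i * T i j)"
    define b where "b = (\<lambda>j. \<Sum>l<6*k. S j l * f (\<xi> l))"
    define g where "g = (\<lambda>x. \<Sum>i<k. c i * w i x)"
    define e where "e = (\<lambda>x. \<Sum>j<N. (a j - b j) * v j x)"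
    have g_eq: "g x = (\<Sum>j<N. a j * v j x)" if "\<forall>i<k. w i x = (\<Sum>j<N. T i j * v j x)" for x
    proof -
      have "g x = (\<Sum>i<k. \<Sum>j<N. c i * (T i j * v j x))"
        using that by (simp add: g_def sum_distrib_left)
      also have "\<dots> = (\<Sum>j<N. \<Sum>i<k. c i * (T i j * v j x))"
        by (rule sum.swap)
      finally show ?thesis by (simp add: a_def sum_distrib_right mult.assoc)
    qed
    have \<psi>_eq: "(\<Sum>l<6*k. f (\<xi> l) * \<psi> l x) = (\<Sum>j<N. b j * v j x)" for x
      unfolding \<psi>_def b_def sum_distrib_left sum_distrib_right
      by (subst sum.swap) (simp add: mult_ac)
    have fg: "square_integrable M (\<lambda>x. f x - g x)"
      unfolding g_def by (intro square_integrable_diff f square_integrable_sum square_integrable_scale w)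
    have fb: "square_integrable M (\<lambda>x. f x - (\<Sum>l<6*k. f (\<xi> l) * \<psi> l x))"
      by (intro square_integrable_diff f square_integrable_sum square_integrable_scale \<psi>)
    have e: "has_bochner_integral M (\<lambda>x. (e x)\<^sup>2) (\<Sum>j<N. (a j - b j)\<^sup>2)"
      using has_bochner_integral_orthonormal[OF orth, of "\<lambda>j. a j - b j" "\<lambda>j. a j - b j"]
      by (simp add: e_def power2_eq_square)
    have ptw: "AE x in M. (f x - (\<Sum>l<6*k. f (\<xi> l) * \<psi> l x))\<^sup>2 \<le> 2 * (f x - g x)\<^sup>2 + 2 * (e x)\<^sup>2"
      using T
    proof eventually_elim
      case (elim x)
      have "f x - (\<Sum>l<6*k. f (\<xi> l) * \<psi> l x) = (f x - g x) + e x"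
        unfolding \<psi>_eq e_def g_eq[OF elim] by (simp add: left_diff_distrib sum_subtractf)
      moreover have "((f x - g x) + e x)\<^sup>2 \<le> 2 * (f x - g x)\<^sup>2 + 2 * (e x)\<^sup>2"
        using zero_le_power2[of "(f x - g x) - e x"] by (simp add: power2_sum power2_diff)
      ultimately show ?case by (simp only:)
    qed
    have "(\<integral>x. (f x - (\<Sum>l<6*k. f (\<xi> l) * \<psi> l x))\<^sup>2 \<partial>M) \<le> (\<integral>x. 2 * (f x - g x)\<^sup>2 + 2 * (e x)\<^sup>2 \<partial>M)"
      using fb fg e ptw
      by (intro integral_mono_AE) (auto simp: square_integrable_def has_bochner_integral_iff)
    also have "\<dots> = 2 * (\<integral>x. (f x - g x)\<^sup>2 \<partial>M) + 2 * (\<Sum>j<N. (a j - b j)\<^sup>2)"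
      using fg e by (simp add: square_integrable_def has_bochner_integral_iff)
    also have "2 * (\<Sum>j<N. (a j - b j)\<^sup>2) = 2 / real k * (real k * (\<Sum>j<N. (a j - b j)\<^sup>2))"
      using k by simp
    also have "real k * (\<Sum>j<N. (a j - b j)\<^sup>2) \<le> (\<Sum>l<6*k. (f (\<xi> l) - (\<Sum>i<N. a i * v i (\<xi> l)))\<^sup>2)"
      unfolding b_def by (rule S)
    also have "\<dots> = (\<Sum>l<6*k. (f (\<xi> l) - g (\<xi> l))\<^sup>2)"
      using g_eq[OF T\<xi>] by (intro sum.cong) auto
    finally show ?thesis
      using k by (simp add: g_def divide_right_mono)
  qed
  with \<xi> \<psi> show ?thesis by (rule that)
qed

section \<open>Continuous functions as square-integrable functions\<close>

lemma borel_measurable_continuous_map: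
  fixes f :: "'a \<Rightarrow> 'b::topological_space"
  assumes \<mu>: "borel_probability_on X \<mu>" and f: "continuous_map X euclidean f"
  shows "f \<in> borel_measurable \<mu>"
proof (rule borel_measurableI)
  fix S :: "'b set" assume "open S"
  then have "openin X {x \<in> topspace X. f x \<in> S}"
    using f by (auto simp: continuous_map_def)
  moreover have "f -` S \<inter> space \<mu> = {x \<in> topspace X. f x \<in> S}"
    using \<mu> by (auto simp: borel_probability_on_def)
  ultimately show "f -` S \<inter> space \<mu> \<in> sets \<mu>"
    using \<mu> by (auto simp: borel_probability_on_def)
qed

lemma C_space_borel_measurable:
  assumes "borel_probability_on X \<mu>" "f \<in> mspace (C_space X)"
  shows "f \<in> borel_measurable \<mu>"
  using assms by (auto intro: borel_measurable_continuous_map)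

lemma C_space_bounded:
  assumes "f \<in> mspace (C_space X)"
  obtains K where "\<And>x. x \<in> topspace X \<Longrightarrow> cmod (f x) \<le> K"
proof -
  have "Met_TC.mbounded (f ` topspace X)"
    using assms by simp
  then obtain z K where "\<And>x. x \<in> topspace X \<Longrightarrow> cmod (z - f x) \<le> K"
    unfolding Met_TC.mbounded_def by (auto simp: image_subset_iff dist_norm)
  then have "cmod (f x) \<le> cmod z + K" if "x \<in> topspace X" for x
    using that norm_triangle_sub[of "f x" z] by (fastforce simp: norm_minus_commute[of z])
  then show ?thesis by (rule that)
qed

text \<open>Elements of \<open>C_space\<close> are measurable and bounded, and the measure is
  finite.\<close>

lemma C_space_square_integrable:
  assumes \<mu>: "borel_probability_on X \<mu>" and f: "f \<in> mspace (C_space X)"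
  shows "square_integrable \<mu> (\<lambda>x. Re (f x))" "square_integrable \<mu> (\<lambda>x. Im (f x))"
proof -
  interpret prob_space \<mu> using \<mu> by (simp add: borel_probability_on_def)
  have space: "space \<mu> = topspace X" using \<mu> by (simp add: borel_probability_on_def)
  have meas: "f \<in> borel_measurable \<mu>" by (rule C_space_borel_measurable[OF \<mu> f])
  obtain K where K: "\<And>x. x \<in> topspace X \<Longrightarrow> cmod (f x) \<le> K"
    using C_space_bounded[OF f] by blast
  have "(Re (f x))\<^sup>2 \<le> K\<^sup>2 \<and> (Im (f x))\<^sup>2 \<le> K\<^sup>2" if "x \<in> topspace X" for x
    using K[OF that] abs_Re_le_cmod[of "f x"] abs_Im_le_cmod[of "f x"]
    by (auto intro!: power2_le_iff_abs_le[THEN iffD2])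
  then show "square_integrable \<mu> (\<lambda>x. Re (f x))" "square_integrable \<mu> (\<lambda>x. Im (f x))"
    using meas unfolding square_integrable_def
    by (auto intro!: integrable_const_bound[of _ "K\<^sup>2"] AE_I2 simp: space)
qed

lemma sum_lessThan_add: "(\<Sum>i<n+m. h i) = (\<Sum>i<n. h i) + (\<Sum>i<m. h (n + i))"
  for n m :: nat and h :: "nat \<Rightarrow> real"
  by (induction m) (simp_all add: add.assoc)

text \<open>Moving the factor to the other side leaves an infimum or supremum bare, so that its
  universal property applies.\<close>

lemma ennreal_le_4_mult_iff: "ennreal (1/4) * x \<le> y \<longleftrightarrow> x \<le> ennreal 4 * y"
proof -
  have "ennreal 4 * ennreal (1/4) = 1" "ennreal (1/4) * ennreal 4 = 1"
    by (simp_all add: ennreal_mult[symmetric] del: ennreal_numeral)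
  then have *: "ennreal 4 * (ennreal (1/4) * x) = x" "ennreal (1/4) * (ennreal 4 * y) = y" for x y
    by (simp_all only: mult.assoc[symmetric] mult_1)
  show ?thesis
    using mult_left_mono[of "ennreal (1/4) * x" y "ennreal 4", OF _ zero_le]
      mult_left_mono[of x "ennreal 4 * y" "ennreal (1/4)", OF _ zero_le]
    unfolding * by blast
qed

section \<open>Recovery of complex functions\<close>

text \<open>The real and imaginary parts of the \<open>u i\<close> are \<open>2 * n\<close> real
  functions, hence \<open>6 * (2 * n)\<close> points. The real and imaginary parts of
  \<open>f\<close> are recovered separately from the same points.\<close>

lemma linear_recovery_C_space:
  assumes \<mu>: "borel_probability_on X \<mu>" and n: "1 \<le> n"
    and u: "u \<in> {..<n} \<rightarrow> mspace (C_space X)"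
  obtains \<xi> \<Phi> where "\<xi> \<in> {..<12 * n} \<rightarrow> topspace X" "linear_into_L2 (12 * n) \<mu> \<Phi>"
    "\<And>f c. f \<in> mspace (C_space X) \<Longrightarrow>
      L2_norm \<mu> (\<lambda>x. f x - \<Phi> (samples (12 * n) \<xi> f) x)
        \<le> ennreal 4 * unif_norm (topspace X) (\<lambda>x. f x - (\<Sum>i<n. c i * u i x))"
proof -
  interpret prob_space \<mu> using \<mu> by (simp add: borel_probability_on_def)
  have space: "space \<mu> = topspace X" using \<mu> by (simp add: borel_probability_on_def)
  let ?m = "12 * n"
  define w where "w = (\<lambda>i x. if i < n then Re (u i x) else Im (u (i - n) x))"
  have w: "square_integrable \<mu> (w i)" if "i < 2 * n" for i
  proof (cases "i < n")
    case True
    then show ?thesis using C_space_square_integrable(1)[OF \<mu>, of "u i"] u by (auto simp: w_def Pi_iff)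
  next
    case False
    then show ?thesis
      using C_space_square_integrable(2)[OF \<mu>, of "u (i - n)"] u that by (auto simp: w_def Pi_iff)
  qed
  obtain \<xi> \<psi> where \<xi>: "\<And>l. l < ?m \<Longrightarrow> \<xi> l \<in> topspace X"
    and \<psi>: "\<And>l. square_integrable \<mu> (\<psi> l)"
    and rec: "\<And>f c. square_integrable \<mu> f \<Longrightarrow>
      (\<integral>x. (f x - (\<Sum>l<?m. f (\<xi> l) * \<psi> l x))\<^sup>2 \<partial>\<mu>)
      \<le> 2 * (\<integral>x. (f x - (\<Sum>i<2*n. c i * w i x))\<^sup>2 \<partial>\<mu>)
        + 1 / real n * (\<Sum>l<?m. (f (\<xi> l) - (\<Sum>i<2*n. c i * w i (\<xi> l)))\<^sup>2)"
    using linear_recovery[of "2 * n" w] w n by (auto simp: space)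
  \<comment> \<open>Since each \<open>\<psi> l\<close> is real, the complex-linear extension acts
    separately on the real and imaginary parts of the samples.\<close>
  define \<Phi> where "\<Phi> = (\<lambda>y x. \<Sum>l<?m. y l * complex_of_real (\<psi> l x))"
  have Re_\<Phi>: "Re (\<Phi> y x) = (\<Sum>l<?m. Re (y l) * \<psi> l x)"
    and Im_\<Phi>: "Im (\<Phi> y x) = (\<Sum>l<?m. Im (y l) * \<psi> l x)" for y x
    by (simp_all add: \<Phi>_def)
  have sq_\<Phi>: "square_integrable \<mu> (\<lambda>x. Re (\<Phi> y x))" "square_integrable \<mu> (\<lambda>x. Im (\<Phi> y x))" for y
    unfolding Re_\<Phi> Im_\<Phi> by (intro square_integrable_sum square_integrable_scale \<psi>)+
  have \<Phi>: "linear_into_L2 ?m \<mu> \<Phi>"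
    unfolding linear_into_L2_def
  proof (intro conjI ballI allI AE_I2 funcsetI)
    fix y
    have "\<Phi> y \<in> borel_measurable \<mu>"
      unfolding borel_measurable_complex_iff using sq_\<Phi> by (simp add: square_integrable_def)
    then show "\<Phi> y \<in> L2 \<mu>"
      using sq_\<Phi>[of y] by (simp add: L2_def cmod_power2 square_integrable_def)
  qed (simp_all add: \<Phi>_def distrib_right sum.distrib sum_distrib_left mult.assoc)
  have main: "L2_norm \<mu> (\<lambda>x. f x - \<Phi> (samples ?m \<xi> f) x)
      \<le> ennreal 4 * unif_norm (topspace X) (\<lambda>x. f x - (\<Sum>i<n. c i * u i x))"
    if f: "f \<in> mspace (C_space X)" for f c
  proof (cases "unif_norm (topspace X) (\<lambda>x. f x - (\<Sum>i<n. c i * u i x))")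
    case top
    then show ?thesis by (simp add: ennreal_mult_top)
  next
    case (real \<eta>)
    define g where "g = (\<lambda>x. \<Sum>i<n. c i * u i x)"
    have \<eta>: "cmod (f x - g x) \<le> \<eta>" if "x \<in> topspace X" for x
    proof -
      have "ennreal (cmod (f x - g x)) \<le> ennreal \<eta>"
        using SUP_upper[OF that, of "\<lambda>x. ennreal (cmod (f x - g x))"] real
        by (simp add: unif_norm_def g_def)
      then show ?thesis using real by simp
    qed
    \<comment> \<open>\<open>a\<close> and \<open>b\<close> come from expanding the real and
      imaginary parts of \<open>c i * u i\<close>, in the order used by \<open>w\<close>.\<close>
    define a where "a = (\<lambda>i. if i < n then Re (c i) else - Im (c (i - n)))"
    define b where "b = (\<lambda>i. if i < n then Im (c i) else Re (c (i - n)))"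
    have Re_g: "(\<Sum>i<2*n. a i * w i x) = Re (g x)" and Im_g: "(\<Sum>i<2*n. b i * w i x) = Im (g x)" for x
      by (simp_all add: mult_2 sum_lessThan_add a_def b_def w_def g_def sum_subtractf sum.distrib sum_negf)
    note sq_f = C_space_square_integrable[OF \<mu> f]
    have sq_g: "square_integrable \<mu> (\<lambda>x. Re (g x))" "square_integrable \<mu> (\<lambda>x. Im (g x))"
      unfolding Re_g[symmetric] Im_g[symmetric]
      by (intro square_integrable_sum square_integrable_scale w; assumption)+
    note sq_fg = square_integrable_diff[OF sq_f(1) sq_g(1)] square_integrable_diff[OF sq_f(2) sq_g(2)]
    note sq_err = square_integrable_diff[OF sq_f(1) sq_\<Phi>(1)] square_integrable_diff[OF sq_f(2) sq_\<Phi>(2)]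
    let ?s = "samples ?m \<xi> f"
    have cmod_sq: "(cmod (p - q))\<^sup>2 = (Re p - Re q)\<^sup>2 + (Im p - Im q)\<^sup>2" for p q
      by (simp add: cmod_power2)
    have "(\<integral>x. (cmod (f x - \<Phi> ?s x))\<^sup>2 \<partial>\<mu>)
        = (\<integral>x. (Re (f x) - Re (\<Phi> ?s x))\<^sup>2 \<partial>\<mu>) + (\<integral>x. (Im (f x) - Im (\<Phi> ?s x))\<^sup>2 \<partial>\<mu>)"
      unfolding cmod_sq using sq_err[of ?s]
      by (intro Bochner_Integration.integral_add) (auto simp: square_integrable_def)
    also have "\<dots> \<le> (2 * (\<integral>x. (Re (f x) - Re (g x))\<^sup>2 \<partial>\<mu>)
          + 1 / real n * (\<Sum>l<?m. (Re (f (\<xi> l)) - Re (g (\<xi> l)))\<^sup>2))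
        + (2 * (\<integral>x. (Im (f x) - Im (g x))\<^sup>2 \<partial>\<mu>)
          + 1 / real n * (\<Sum>l<?m. (Im (f (\<xi> l)) - Im (g (\<xi> l)))\<^sup>2))"
    proof (rule add_mono)
      show "(\<integral>x. (Re (f x) - Re (\<Phi> ?s x))\<^sup>2 \<partial>\<mu>) \<le> 2 * (\<integral>x. (Re (f x) - Re (g x))\<^sup>2 \<partial>\<mu>)
          + 1 / real n * (\<Sum>l<?m. (Re (f (\<xi> l)) - Re (g (\<xi> l)))\<^sup>2)"
        using rec[OF sq_f(1), of a] by (simp add: Re_\<Phi> Re_g samples_def)
      show "(\<integral>x. (Im (f x) - Im (\<Phi> ?s x))\<^sup>2 \<partial>\<mu>) \<le> 2 * (\<integral>x. (Im (f x) - Im (g x))\<^sup>2 \<partial>\<mu>)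
          + 1 / real n * (\<Sum>l<?m. (Im (f (\<xi> l)) - Im (g (\<xi> l)))\<^sup>2)"
        using rec[OF sq_f(2), of b] by (simp add: Im_\<Phi> Im_g samples_def)
    qed
    also have "\<dots> = 2 * (\<integral>x. (cmod (f x - g x))\<^sup>2 \<partial>\<mu>)
          + 1 / real n * (\<Sum>l<?m. (cmod (f (\<xi> l) - g (\<xi> l)))\<^sup>2)"
      unfolding cmod_sq using sq_fg
      by (subst Bochner_Integration.integral_add)
        (auto simp: square_integrable_def sum.distrib distrib_left add_divide_distrib)
    also have "\<dots> \<le> 2 * \<eta>\<^sup>2 + 1 / real n * (\<Sum>l<?m. \<eta>\<^sup>2)"
    proof (intro add_mono mult_left_mono sum_mono)
      show "(\<integral>x. (cmod (f x - g x))\<^sup>2 \<partial>\<mu>) \<le> \<eta>\<^sup>2"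
      proof (rule integral_le_const)
        show "integrable \<mu> (\<lambda>x. (cmod (f x - g x))\<^sup>2)"
          unfolding cmod_sq using sq_fg by (auto simp: square_integrable_def)
        show "AE x in \<mu>. (cmod (f x - g x))\<^sup>2 \<le> \<eta>\<^sup>2"
          using \<eta> by (intro AE_I2 power_mono) (auto simp: space)
      qed
      show "(cmod (f (\<xi> l) - g (\<xi> l)))\<^sup>2 \<le> \<eta>\<^sup>2" if "l \<in> {..<?m}" for l
        using that \<eta>[OF \<xi>] by (intro power_mono) auto
    qed auto
    \<comment> \<open>The \<open>12 * n\<close> sample terms of weight \<open>1 / n\<close>
      contribute 12 and the integral contributes 2.\<close>
    also have "\<dots> = 14 * \<eta>\<^sup>2"
      using n by simp
    also have "\<dots> \<le> (4 * \<eta>)\<^sup>2"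
      by (simp add: power_mult_distrib)
    finally have "sqrt (\<integral>x. (cmod (f x - \<Phi> ?s x))\<^sup>2 \<partial>\<mu>) \<le> 4 * \<eta>"
      using real by (intro real_le_lsqrt) auto
    then have "L2_norm \<mu> (\<lambda>x. f x - \<Phi> ?s x) \<le> ennreal (4 * \<eta>)"
      unfolding L2_norm_def by (rule ennreal_leI)
    also have "\<dots> = ennreal 4 * ennreal \<eta>"
      using real by (intro ennreal_mult) auto
    finally show ?thesis unfolding real(2) .
  qed
  show ?thesis using \<xi> by (intro that[OF _ \<Phi> main]) auto
qed

section \<open>Comparison of the widths\<close>

text \<open>For given \<open>u\<close>, one choice of points and operator serves all
  \<open>f\<close> and all \<open>c\<close>. The infimum over \<open>c\<close> may thus be taken for
  each \<open>f\<close> separately, before the supremum over \<open>F\<close> and the infimum over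
  \<open>u\<close>.\<close>

lemma opt_linear_recovery_le_kolmogorov_width:
  assumes \<mu>: "borel_probability_on X \<mu>" and F: "F \<subseteq> mspace (C_space X)" and n: "1 \<le> n"
  shows "opt_linear_recovery X \<mu> (12 * n) F \<le> ennreal 4 * kolmogorov_width X n F"
proof -
  have "ennreal (1/4) * opt_linear_recovery X \<mu> (12 * n) F \<le> kolmogorov_width X n F"
    unfolding kolmogorov_width_def
  proof (rule INF_greatest)
    fix u assume u: "u \<in> {..<n} \<rightarrow> mspace (C_space X)"
    let ?d = "\<lambda>f. INF c :: nat \<Rightarrow> complex. unif_norm (topspace X) (\<lambda>x. f x - (\<Sum>i<n. c i * u i x))"
    obtain \<xi> \<Phi> where \<xi>: "\<xi> \<in> {..<12 * n} \<rightarrow> topspace X" and \<Phi>: "linear_into_L2 (12 * n) \<mu> \<Phi>" and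
      rec: "\<And>f c. f \<in> mspace (C_space X) \<Longrightarrow> L2_norm \<mu> (\<lambda>x. f x - \<Phi> (samples (12 * n) \<xi> f) x)
        \<le> ennreal 4 * unif_norm (topspace X) (\<lambda>x. f x - (\<Sum>i<n. c i * u i x))"
      using linear_recovery_C_space[OF \<mu> n u] by blast
    have "opt_linear_recovery X \<mu> (12 * n) F
        \<le> (SUP f\<in>F. L2_norm \<mu> (\<lambda>x. f x - \<Phi> (samples (12 * n) \<xi> f) x))"
      unfolding opt_linear_recovery_def using \<xi> \<Phi> by (intro INF_lower2[of \<xi>] INF_lower2[of \<Phi>]) auto
    also have "\<dots> \<le> ennreal 4 * (SUP f\<in>F. ?d f)"
    proof (rule SUP_least)
      fix f assume f: "f \<in> F"
      have "ennreal (1/4) * L2_norm \<mu> (\<lambda>x. f x - \<Phi> (samples (12 * n) \<xi> f) x) \<le> ?d f"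
        unfolding ennreal_le_4_mult_iff[symmetric]
        using rec[of f] f F by (intro INF_greatest) (auto simp: ennreal_le_4_mult_iff)
      also have "\<dots> \<le> (SUP f\<in>F. ?d f)"
        using f by (rule SUP_upper)
      finally show "L2_norm \<mu> (\<lambda>x. f x - \<Phi> (samples (12 * n) \<xi> f) x) \<le> ennreal 4 * (SUP f\<in>F. ?d f)"
        by (simp only: ennreal_le_4_mult_iff)
    qed
    finally show "ennreal (1/4) * opt_linear_recovery X \<mu> (12 * n) F \<le> (SUP f\<in>F. ?d f)"
      by (simp only: ennreal_le_4_mult_iff)
  qed
  then show ?thesis by (simp only: ennreal_le_4_mult_iff)
qed

theorem theorem1p1:
  shows "\<exists>b B :: real. 0 < b \<and> 0 < B \<and>
    (\<forall>(d::nat) (\<Omega> :: (nat \<Rightarrow> real) set) (\<mu> :: (nat \<Rightarrow> real) measure)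
      (F :: ((nat \<Rightarrow> real) \<Rightarrow> complex) set) (n::nat).
      1 \<le> d \<longrightarrow>
      compactin (Euclidean_space d) \<Omega> \<longrightarrow>
      borel_probability_on (subtopology (Euclidean_space d) \<Omega>) \<mu> \<longrightarrow>
      compactin (mtopology_of (C_space (subtopology (Euclidean_space d) \<Omega>))) F \<longrightarrow>
      1 \<le> n \<longrightarrow>
      opt_linear_recovery (subtopology (Euclidean_space d) \<Omega>) \<mu> (nat \<lfloor>b * real n\<rfloor>) F
        \<le> ennreal B * kolmogorov_width (subtopology (Euclidean_space d) \<Omega>) n F)"
\<comment> \<open>The value 12 counts six points for each of \<open>2 * n\<close> real functions; 4
  bounds the square root of 14.\<close>
proof (rule exI[of _ 12], rule exI[of _ 4], intro conjI allI impI)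
  fix d :: nat and \<Omega> :: "(nat \<Rightarrow> real) set" and \<mu> :: "(nat \<Rightarrow> real) measure"
    and F :: "((nat \<Rightarrow> real) \<Rightarrow> complex) set" and n :: nat
  let ?X = "subtopology (Euclidean_space d) \<Omega>"
  assume \<mu>: "borel_probability_on ?X \<mu>" and F: "compactin (mtopology_of (C_space ?X)) F" and n: "1 \<le> n"
  have "F \<subseteq> mspace (C_space ?X)"
    using compactin_subset_topspace[OF F] by simp
  moreover have "nat \<lfloor>12 * real n\<rfloor> = 12 * n"
    by linarith
  ultimately show "opt_linear_recovery ?X \<mu> (nat \<lfloor>12 * real n\<rfloor>) F \<le> ennreal 4 * kolmogorov_width ?X n F"
    using opt_linear_recovery_le_kolmogorov_width[OF \<mu> _ n] by simp
qed simp_all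

end
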